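(* Let $\gamma>1$. Consider the time-optimal control problem: find a Lebesgue measurable control $u$ with $-1\le u(t)\le 1$ such that, starting from $(x_1(0),x_2(0))=(1,0)$, the system $$\dot x_1=x_2,\qquad \dot x_2=-u x_1+\frac{1}{x_1^2}$$ reaches the final point $(x_1(T),x_2(T))=(\gamma,0)$ in minimum time $T$, under the state constraint $x_2(t)\ge 0$. Then the optimal trajectory has the bang-bang form $XY$.
   Context: The state $(x_1,x_2)$ lies in $D=\{(x_1,x_2)\in\mathbb{R}^2: x_1>0,\ x_2\ge 0\}$. Admissible controls are Lebesgue measurable functions with values in $[-1,1]$ (almost everywhere); the corresponding trajectories are the absolutely continuous solutions of the system. Write the system as $\dot x=f(x)+u\,g(x)$ with $f(x)=(x_2,\,1/x_1^2)$ and $g(x)=(0,\,-x_1)$. An $X$-trajectory is a trajectory of $X=f-g$, i.e. one corresponding to the constant control $u=-1$; a $Y$-trajectory is a trajectory of $Y=f+g$, i.e. one corresponding to the constant control $u=+1$. A bang-bang trajectory is a finite concatenation of $X$- and $Y$-trajectories. The form $XY$ means an $X$-trajectory followed by a $Y$-trajectory: there is a switching time $t_1\in(0,T)$ with $u=-1$ on $(0,t_1)$ and $u=+1$ on $(t_1,T)$ (almost everywhere). *)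

theory Defs
  imports "HOL-Analysis.Analysis"
begin

text \<open>
  Absolute continuity of a function on a compact interval. A finite family of
  non-overlapping compact subintervals of \<open>{a..b}\<close> is a \<open>d division_of S\<close> with
  \<open>S \<subseteq> {a..b}\<close>; such a \<open>k \<in> d\<close> is nonempty and equals \<open>{Inf k..Sup k}\<close>.
\<close>

definition absolutely_continuous_on_interval ::
    "real \<Rightarrow> real \<Rightarrow> (real \<Rightarrow> 'a::metric_space) \<Rightarrow> bool" where
  "absolutely_continuous_on_interval a b x \<longleftrightarrow>
     (\<forall>\<epsilon>>0. \<exists>\<delta>>0. \<forall>d S. d division_of S \<and> S \<subseteq> {a..b} \<and> (\<Sum>k\<in>d. Sup k - Inf k) < \<delta>
        \<longrightarrow> (\<Sum>k\<in>d. dist (x (Inf k)) (x (Sup k))) < \<epsilon>)"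

definition state_space :: "(real \<times> real) set" where
  "state_space = {p. fst p > 0 \<and> snd p \<ge> 0}"

definition f_field :: "real \<times> real \<Rightarrow> real \<times> real" where
  "f_field p = (snd p, 1 / (fst p)\<^sup>2)"

definition g_field :: "real \<times> real \<Rightarrow> real \<times> real" where
  "g_field p = (0, - fst p)"

text \<open>
  Caratheodory solutions: the equation holds for almost every time only. The state
  constraint \<open>snd (x t) \<ge> 0\<close> is part of the membership in \<^const>\<open>state_space\<close>.
\<close>

definition solution ::
    "(real \<Rightarrow> real \<times> real \<Rightarrow> real \<times> real) \<Rightarrow> real \<Rightarrow> real \<Rightarrow> (real \<Rightarrow> real \<times> real) \<Rightarrow> bool" where
  "solution V a b x \<longleftrightarrow>
     absolutely_continuous_on_interval a b x \<and>
     (\<forall>t\<in>{a..b}. x t \<in> state_space) \<and>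
     (AE t in lebesgue_on {a..b}. (x has_vector_derivative V t (x t)) (at t within {a..b}))"

definition trajectory ::
    "(real \<Rightarrow> real) \<Rightarrow> real \<Rightarrow> real \<Rightarrow> (real \<Rightarrow> real \<times> real) \<Rightarrow> bool" where
  "trajectory u = solution (\<lambda>t p. f_field p + u t *\<^sub>R g_field p)"

definition X_trajectory :: "real \<Rightarrow> real \<Rightarrow> (real \<Rightarrow> real \<times> real) \<Rightarrow> bool" where
  "X_trajectory = solution (\<lambda>t p. f_field p - g_field p)"

definition Y_trajectory :: "real \<Rightarrow> real \<Rightarrow> (real \<Rightarrow> real \<times> real) \<Rightarrow> bool" where
  "Y_trajectory = solution (\<lambda>t p. f_field p + g_field p)"

definition admissible_control :: "real \<Rightarrow> (real \<Rightarrow> real) \<Rightarrow> bool" where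
  "admissible_control T u \<longleftrightarrow>
     u \<in> borel_measurable (lebesgue_on {0..T}) \<and>
     (AE t in lebesgue_on {0..T}. - 1 \<le> u t \<and> u t \<le> 1)"

definition feasible :: "real \<Rightarrow> real \<Rightarrow> (real \<Rightarrow> real) \<Rightarrow> (real \<Rightarrow> real \<times> real) \<Rightarrow> bool" where
  "feasible \<gamma> T u x \<longleftrightarrow>
     0 \<le> T \<and> admissible_control T u \<and> trajectory u 0 T x \<and> x 0 = (1, 0) \<and> x T = (\<gamma>, 0)"

definition time_optimal :: "real \<Rightarrow> real \<Rightarrow> (real \<Rightarrow> real) \<Rightarrow> (real \<Rightarrow> real \<times> real) \<Rightarrow> bool" where
  "time_optimal \<gamma> T u x \<longleftrightarrow>
     feasible \<gamma> T u x \<and> (\<forall>T' u' x'. feasible \<gamma> T' u' x' \<longrightarrow> T \<le> T')"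

definition form_XY :: "real \<Rightarrow> (real \<Rightarrow> real) \<Rightarrow> (real \<Rightarrow> real \<times> real) \<Rightarrow> bool" where
  "form_XY T u x \<longleftrightarrow>
     (\<exists>t1. 0 < t1 \<and> t1 < T \<and>
        X_trajectory 0 t1 x \<and> (AE t in lebesgue_on {0<..<t1}. u t = - 1) \<and>
        Y_trajectory t1 T x \<and> (AE t in lebesgue_on {t1<..<T}. u t = 1))"

end

theory Submission
  imports Defs
begin

text \<open>
  Write \<open>q = x1\<close> and \<open>v = x2\<close>. Since \<open>v = q'\<close> is nonnegative, a feasible trajectory moves
  monotonically from \<open>q = 1\<close> to \<open>q = \<gamma>\<close>, and apart from periods of rest its duration is the
  integral of \<open>dq / v\<close>: being fast means having, at every position, as much kinetic energy as possible.

  For a constant control \<open>\<sigma>\<close> the force \<open>1 / q\<^sup>2 - \<sigma> q\<close> is the derivative of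
  \<open>potential \<sigma> q = - 1 / q - \<sigma> q\<^sup>2 / 2\<close>. Along any feasible trajectory the energy
  \<open>v\<^sup>2 / 2 - potential \<sigma> q\<close> has derivative \<open>(\<sigma> - u) q v\<close> almost everywhere, so it is nonincreasing for
  \<open>\<sigma> = - 1\<close> and nondecreasing for \<open>\<sigma> = 1\<close>. Comparing with the initial and the final point, where \<open>v = 0\<close>,
  bounds \<open>v\<^sup>2 / 2\<close> by the kinetic energy of the \<open>X\<close>-arc issuing from \<open>(1, 0)\<close> and by that of the
  \<open>Y\<close>-arc arriving at \<open>(\<gamma>, 0)\<close> (lemma \<open>speed_bounds\<close>). The smaller of the two, \<open>max_kinetic\<close>, is
  given by the first arc up to \<open>switch_point\<close> and by the second one beyond.

  Let \<open>travel_time \<gamma> q\<close> be the integral of \<open>dq / sqrt (2 max_kinetic)\<close> from \<open>1\<close> to \<open>q\<close>. The function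
  \<open>t - travel_time \<gamma> (q t)\<close> is nondecreasing during the motion, hence the duration is at least
  \<open>travel_time \<gamma> \<gamma>\<close>. If the duration equals this bound, the function vanishes identically, so the
  speed bound is attained at every time, the energy for \<open>\<sigma> = - 1\<close> is constant before the switch
  point is reached, the one for \<open>\<sigma> = 1\<close> is constant afterwards, and the formula for their
  derivatives forces \<open>u = - 1\<close> and then \<open>u = 1\<close> (lemma \<open>minimal_time_imp_form_XY\<close>). Conversely,
  inverting \<open>travel_time\<close> yields a trajectory that attains the bound (lemma
  \<open>ex_feasible_travel_time\<close>), so that the bound is the minimal time.

  As the equation of motion holds almost everywhere only, monotonicity of the energies rests on the
  fundamental theorem of calculus for absolutely continuous functions (lemma
  \<open>has_integral_derivative_absolutely_continuous\<close>).
\<close>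

section \<open>Absolutely continuous functions\<close>

lemma absolutely_continuous_on_intervalE:
  assumes "absolutely_continuous_on_interval a b x" "\<epsilon> > 0"
  obtains \<delta> where "\<delta> > 0" "\<forall>d S. d division_of S \<longrightarrow> S \<subseteq> {a..b} \<longrightarrow>
        (\<Sum>k\<in>d. Sup k - Inf k) < \<delta> \<longrightarrow> (\<Sum>k\<in>d. dist (x (Inf k)) (x (Sup k))) < \<epsilon>"
proof -
  from assms obtain \<delta> where "\<delta> > 0" and \<delta>: "\<forall>d S. d division_of S \<and> S \<subseteq> {a..b} \<and> (\<Sum>k\<in>d. Sup k - Inf k) < \<delta>
        \<longrightarrow> (\<Sum>k\<in>d. dist (x (Inf k)) (x (Sup k))) < \<epsilon>"
    unfolding absolutely_continuous_on_interval_def by auto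
  show ?thesis
    by (rule that[OF \<open>\<delta> > 0\<close>]) (intro allI impI \<delta>[rule_format] conjI)
qed

lemma absolutely_continuous_on_interval_subset:
  assumes "absolutely_continuous_on_interval a b x" "{a'..b'} \<subseteq> {a..b}"
  shows "absolutely_continuous_on_interval a' b' x"
  unfolding absolutely_continuous_on_interval_def
proof (intro allI impI)
  fix e :: real assume "e > 0"
  with assms(1) obtain \<delta> where "\<delta> > 0" and \<delta>: "\<forall>d S. d division_of S \<longrightarrow> S \<subseteq> {a..b} \<longrightarrow>
        (\<Sum>k\<in>d. Sup k - Inf k) < \<delta> \<longrightarrow> (\<Sum>k\<in>d. dist (x (Inf k)) (x (Sup k))) < e"
    by (rule absolutely_continuous_on_intervalE)
  show "\<exists>\<delta>>0. \<forall>d S. d division_of S \<and> S \<subseteq> {a'..b'} \<and> (\<Sum>k\<in>d. Sup k - Inf k) < \<delta>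
        \<longrightarrow> (\<Sum>k\<in>d. dist (x (Inf k)) (x (Sup k))) < e"
  proof (intro exI conjI allI impI)
    fix d S assume "d division_of S \<and> S \<subseteq> {a'..b'} \<and> (\<Sum>k\<in>d. Sup k - Inf k) < \<delta>"
    then show "(\<Sum>k\<in>d. dist (x (Inf k)) (x (Sup k))) < e"
      by (intro \<delta>[rule_format, of d S]) (use assms(2) in auto)
  qed fact
qed

lemma absolutely_continuous_on_interval_imp_continuous_on:
  fixes x :: "real \<Rightarrow> 'a::metric_space"
  assumes "absolutely_continuous_on_interval a b x"
  shows "continuous_on {a..b} x"
proof -
  have "\<exists>d>0. \<forall>s\<in>{a..b}. \<forall>t\<in>{a..b}. dist t s < d \<longrightarrow> dist (x t) (x s) < e" if "e > 0" for e
  proof -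
    obtain \<delta> where "\<delta> > 0" and \<delta>: "\<forall>d S. d division_of S \<longrightarrow> S \<subseteq> {a..b} \<longrightarrow>
        (\<Sum>k\<in>d. Sup k - Inf k) < \<delta> \<longrightarrow> (\<Sum>k\<in>d. dist (x (Inf k)) (x (Sup k))) < e"
      using assms \<open>e > 0\<close> by (rule absolutely_continuous_on_intervalE)
    have *: "dist (x s) (x t) < e" if "s \<in> {a..b}" "t \<in> {a..b}" "s \<le> t" "t - s < \<delta>" for s t
      using \<delta>[rule_format, of "{{s..t}}" "{s..t}"] that division_of_self[of s t] by auto
    have "dist (x t) (x s) < e" if "s \<in> {a..b}" "t \<in> {a..b}" "dist t s < \<delta>" for s t
      using *[of s t] *[of t s] that
      by (cases "s \<le> t") (auto simp: dist_real_def[of t s] dist_real_def[of s t] dist_commute)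
    then have "\<forall>s\<in>{a..b}. \<forall>t\<in>{a..b}. dist t s < \<delta> \<longrightarrow> dist (x t) (x s) < e"
      by simp
    with \<open>\<delta> > 0\<close> show ?thesis by blast
  qed
  then show ?thesis
    by (intro uniformly_continuous_imp_continuous) (auto simp: uniformly_continuous_on_def)
qed

lemma lipschitz_compose_absolutely_continuous:
  assumes ac: "absolutely_continuous_on_interval a b x"
    and F: "L-lipschitz_on C F" and sub: "x ` {a..b} \<subseteq> C"
  shows "absolutely_continuous_on_interval a b (\<lambda>t. F (x t))"
  unfolding absolutely_continuous_on_interval_def
proof (intro allI impI)
  fix e :: real assume "e > 0"
  have L: "L \<ge> 0" using F by (rule lipschitz_on_nonneg)
  then have "e / (L + 1) > 0" using \<open>e > 0\<close> by simp
  with ac obtain \<delta> where "\<delta> > 0" and \<delta>: "\<forall>d S. d division_of S \<longrightarrow> S \<subseteq> {a..b} \<longrightarrow>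
        (\<Sum>k\<in>d. Sup k - Inf k) < \<delta> \<longrightarrow> (\<Sum>k\<in>d. dist (x (Inf k)) (x (Sup k))) < e / (L + 1)"
    by (rule absolutely_continuous_on_intervalE)
  have "(\<Sum>k\<in>d. dist (F (x (Inf k))) (F (x (Sup k)))) < e"
    if d: "d division_of S" and S: "S \<subseteq> {a..b}" and len: "(\<Sum>k\<in>d. Sup k - Inf k) < \<delta>" for d S
  proof -
    have ends: "Inf k \<in> {a..b} \<and> Sup k \<in> {a..b}" if "k \<in> d" for k
    proof -
      obtain u v where k: "k = {u..v}" using division_ofD(4)[OF d \<open>k \<in> d\<close>] by auto
      moreover have "k \<noteq> {}" "k \<subseteq> {a..b}" using division_ofD(2,3)[OF d \<open>k \<in> d\<close>] S by auto
      ultimately show ?thesis by auto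
    qed
    have "(\<Sum>k\<in>d. dist (F (x (Inf k))) (F (x (Sup k))))
        \<le> (\<Sum>k\<in>d. L * dist (x (Inf k)) (x (Sup k)))"
      using ends sub by (intro sum_mono lipschitz_onD[OF F]) blast+
    also have "\<dots> = L * (\<Sum>k\<in>d. dist (x (Inf k)) (x (Sup k)))"
      by (simp add: sum_distrib_left)
    also have "\<dots> \<le> L * (e / (L + 1))"
      using \<delta>[rule_format, OF d S len] L by (intro mult_left_mono) auto
    also have "\<dots> < e"
      using L \<open>e > 0\<close> by (simp add: field_simps)
    finally show ?thesis .
  qed
  then show "\<exists>\<delta>>0. \<forall>d S. d division_of S \<and> S \<subseteq> {a..b} \<and> (\<Sum>k\<in>d. Sup k - Inf k) < \<delta>
        \<longrightarrow> (\<Sum>k\<in>d. dist (F (x (Inf k))) (F (x (Sup k)))) < e"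
    using \<open>\<delta> > 0\<close> by (intro exI[of _ \<delta>]) auto
qed

lemma absolutely_continuous_on_interval_ident:
  "absolutely_continuous_on_interval a b (\<lambda>t. t)"
proof -
  have "(\<Sum>k\<in>d. dist (Inf k) (Sup k)) = (\<Sum>k\<in>d. Sup k - Inf k)"
    if d: "d division_of S" for d and S :: "real set"
  proof (rule sum.cong)
    fix k assume "k \<in> d"
    then obtain u v where k: "k = {u..v}" "k \<noteq> {}"
      using division_ofD(3)[OF d \<open>k \<in> d\<close>] division_ofD(4)[OF d \<open>k \<in> d\<close>] by auto
    then show "dist (Inf k) (Sup k) = Sup k - Inf k" by (auto simp: dist_real_def)
  qed simp
  then have "\<forall>d S. d division_of S \<and> S \<subseteq> {a..b} \<and> (\<Sum>k\<in>d. Sup k - Inf k) < \<epsilon>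
      \<longrightarrow> (\<Sum>k\<in>d. dist (Inf k) (Sup k)) < \<epsilon>" for \<epsilon>
    by auto
  then show ?thesis
    unfolding absolutely_continuous_on_interval_def by blast
qed

text \<open>
  The derivative may be replaced by \<open>0\<close> on the null set \<open>N\<close>. In a fine tagged division the
  intervals with a tag outside \<open>N\<close> are handled as in the theorem for everywhere differentiable
  functions. Those with a tag in \<open>N\<close> lie in an open set of small measure around \<open>N\<close>, so their total
  length is small and absolute continuity makes the total increment over them small.
\<close>

lemma has_integral_derivative_absolutely_continuous:
  fixes x :: "real \<Rightarrow> 'a::banach"
  assumes "a \<le> b" and ac: "absolutely_continuous_on_interval a b x" and N: "negligible N"
    and der: "\<And>t. t \<in> {a..b} - N \<Longrightarrow> (x has_vector_derivative D t) (at t within {a..b})"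
  shows "(D has_integral (x b - x a)) {a..b}"
proof (cases "a = b")
  case False
  with \<open>a \<le> b\<close> have "a < b" by simp
  define D0 where "D0 = (\<lambda>t. if t \<in> N then 0 else D t)"
  have "(D0 has_integral (x b - x a)) (cbox a b)"
    unfolding has_integral_factor_content
  proof (intro allI impI)
    fix e :: real assume "e > 0"
    then have "\<forall>t. \<exists>d>0. t \<in> {a..b} - N \<longrightarrow>
         (\<forall>y\<in>{a..b}. norm (y-t) < d \<longrightarrow> norm (x y - x t - (y-t) *\<^sub>R D t) \<le> e/2 * norm (y-t))"
      using der[unfolded has_vector_derivative_def has_derivative_within_alt]
      by (metis half_gt_zero zero_less_one)
    then obtain d where d: "\<And>t. 0 < d t"
       "\<And>t y. \<lbrakk>t \<in> {a..b} - N; y \<in> {a..b}; norm (y-t) < d t\<rbrakk>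
            \<Longrightarrow> norm (x y - x t - (y-t) *\<^sub>R D t) \<le> e/2 * norm (y-t)"
      by metis
    have "e/2 * (b - a) > 0" using \<open>e > 0\<close> \<open>a < b\<close> by simp
    with ac obtain \<delta> where "\<delta> > 0" and \<delta>: "\<forall>d S. d division_of S \<longrightarrow> S \<subseteq> {a..b} \<longrightarrow>
        (\<Sum>k\<in>d. Sup k - Inf k) < \<delta> \<longrightarrow> (\<Sum>k\<in>d. dist (x (Inf k)) (x (Sup k))) < e/2 * (b - a)"
      by (rule absolutely_continuous_on_intervalE)
    obtain U where "open U" "N \<subseteq> U" and U: "U \<in> lmeasurable" "measure lebesgue U < \<delta>"
    proof -
      obtain U where "open U" "N \<subseteq> U" "U - N \<in> lmeasurable" "emeasure lebesgue (U - N) < ennreal \<delta>"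
        using sets_lebesgue_outer_open[OF negligible_imp_sets[OF N] \<open>\<delta> > 0\<close>] by blast
      moreover have "measure lebesgue (U - N) < \<delta>"
        using calculation \<open>\<delta> > 0\<close> by (simp add: emeasure_eq_measure2 ennreal_less_iff)
      moreover have "U = (U - N) \<union> N" using \<open>N \<subseteq> U\<close> by blast
      moreover have "U \<in> lmeasurable"
        using calculation N by (metis fmeasurable.Un negligible_imp_measurable)
      moreover have "measure lebesgue U = measure lebesgue (U - N)"
        using calculation N by (simp add: measure_Diff_null_set negligible_iff_null_sets fmeasurableD)
      ultimately show ?thesis using that by simp
    qed
    define g where "g = (\<lambda>t. if t \<in> N then U else ball t (d t))"
    have "gauge g"
      using \<open>open U\<close> \<open>N \<subseteq> U\<close> d(1) by (auto simp: gauge_def g_def)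
    moreover have "norm ((\<Sum>(t, k)\<in>p. measure lborel k *\<^sub>R D0 t) - (x b - x a)) \<le> e * measure lborel (cbox a b)"
      if p: "p tagged_division_of (cbox a b)" and fine: "g fine p" for p
    proof -
      note fin = tagged_division_of_finite[OF p]
      have K: "\<exists>u v. k = {u..v} \<and> u \<le> v \<and> t \<in> {u..v} \<and> {u..v} \<subseteq> {a..b}" if tk: "(t,k) \<in> p" for t k
      proof -
        obtain u v where "k = cbox u v" using tagged_division_ofD(4)[OF p tk] by blast
        then show ?thesis using tagged_division_ofD(2,3)[OF p tk] by auto
      qed
      define B where "B = {q \<in> p. fst q \<in> N}"
      have B: "B \<subseteq> p" "finite B" unfolding B_def using fin by auto
      then have Bp: "B tagged_partial_division_of (cbox a b)"
        using p tagged_partial_division_subset unfolding tagged_division_of_def by blast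
      have Bdiv: "snd ` B division_of \<Union>(snd ` B)"
        using Bp by (rule partial_division_of_tagged_division)
      have "\<Union>(snd ` B) \<subseteq> U"
      proof (rule subsetI)
        fix s assume "s \<in> \<Union>(snd ` B)"
        then obtain t k where "(t,k) \<in> B" "s \<in> k" by auto
        then show "s \<in> U" using fineD[OF fine, of t k] unfolding B_def g_def by auto
      qed
      have ends: "measure lebesgue k = Sup k - Inf k \<and> k \<subseteq> {a..b} \<and> Inf k \<le> Sup k" if "(t,k) \<in> p" for t k
        using K[OF that] by auto
      have "(\<Sum>k\<in>snd ` B. Sup k - Inf k) = (\<Sum>k\<in>snd ` B. measure lebesgue k)"
        using ends B by (intro sum.cong) auto
      also have "\<dots> = measure lebesgue (\<Union>(snd ` B))"
        using content_division[OF Bdiv] by simp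
      also have "\<dots> \<le> measure lebesgue U"
        using \<open>\<Union>(snd ` B) \<subseteq> U\<close> U(1) lmeasurable_division[OF Bdiv]
        by (intro measure_mono_fmeasurable fmeasurableD)
      also have "\<dots> < \<delta>" by (fact U)
      finally have "(\<Sum>k\<in>snd ` B. dist (x (Inf k)) (x (Sup k))) < e/2 * (b - a)"
      proof (intro \<delta>[rule_format, OF Bdiv] subsetI)
        fix s assume "s \<in> \<Union>(snd ` B)"
        then obtain t k where "(t,k) \<in> B" "s \<in> k" by auto
        then show "s \<in> {a..b}" using ends[of t k] B(1) by blast
      qed
      moreover have "(\<Sum>(t,k)\<in>B. dist (x (Inf k)) (x (Sup k))) = (\<Sum>k\<in>snd ` B. dist (x (Inf k)) (x (Sup k)))"
      proof -
        \<comment> \<open>A degenerate interval may occur with several tags, so the sum over the tagged intervals equals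
          the sum over the set of intervals only for a function that vanishes on all of them. The
          empty interval counts as degenerate, but Inf and Sup are unspecified there.\<close>
        define w where "w = (\<lambda>k. if k = {} then 0 else dist (x (Inf k)) (x (Sup k)))"
        have ne: "k \<noteq> {}" if "(t,k) \<in> B" for t k
          using K[of t k] that B(1) by auto
        have "(\<Sum>(t,k)\<in>B. dist (x (Inf k)) (x (Sup k))) = (\<Sum>(t,k)\<in>B. w k)"
          using ne by (intro sum.cong) (auto simp: w_def)
        also have "\<dots> = (\<Sum>k\<in>snd ` B. w k)"
          using tagged_partial_division_of_Union_self[OF Bp]
          by (rule sum.over_tagged_division_lemma) (auto simp: w_def not_less dest: antisym)
        also have "\<dots> = (\<Sum>k\<in>snd ` B. dist (x (Inf k)) (x (Sup k)))"
          using ne by (intro sum.cong) (auto simp: w_def)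
        finally show ?thesis .
      qed
      ultimately have bad: "(\<Sum>(t,k)\<in>B. dist (x (Inf k)) (x (Sup k))) \<le> e/2 * (b - a)" by simp
      have good: "norm (measure lborel k *\<^sub>R D t - (x (Sup k) - x (Inf k))) \<le> e/2 * (Sup k - Inf k)"
        if tk: "(t,k) \<in> p - B" for t k
      proof -
        obtain u v where k: "k = {u..v}" "u \<le> v" "t \<in> {u..v}" "{u..v} \<subseteq> {a..b}"
          using K tk by blast
        have "t \<notin> N" using tk unfolding B_def by auto
        then have "k \<subseteq> ball t (d t)" using fineD[OF fine, of t k] tk unfolding g_def by auto
        then have uv: "norm (u - t) < d t" "norm (v - t) < d t"
          using k subsetD[of k "ball t (d t)" u] subsetD[of k "ball t (d t)" v]
          by (auto simp: dist_real_def)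
        have "norm (measure lborel k *\<^sub>R D t - (x (Sup k) - x (Inf k)))
            = norm ((x u - x t - (u - t) *\<^sub>R D t) - (x v - x t - (v - t) *\<^sub>R D t))"
          using k by (simp add: algebra_simps)
        also have "\<dots> \<le> norm (x u - x t - (u - t) *\<^sub>R D t) + norm (x v - x t - (v - t) *\<^sub>R D t)"
          by (rule norm_triangle_ineq4)
        also have "\<dots> \<le> e/2 * norm (u - t) + e/2 * norm (v - t)"
          using k uv \<open>t \<notin> N\<close> by (intro add_mono d(2)) auto
        also have "\<dots> = e/2 * (norm (u - t) + norm (v - t))"
          by (simp add: distrib_left)
        also have "norm (u - t) + norm (v - t) = Sup k - Inf k"
          using k by simp
        finally show ?thesis .
      qed
      have sum_len: "(\<Sum>(t,k)\<in>p. Sup k - Inf k) = b - a"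
        and sum_x: "(\<Sum>(t,k)\<in>p. x (Sup k) - x (Inf k)) = x b - x a"
        using additive_tagged_division_1[of a b p "\<lambda>t. t"] additive_tagged_division_1[of a b p x]
          \<open>a \<le> b\<close> p by auto
      have "(\<Sum>(t,k)\<in>p. measure lborel k *\<^sub>R D0 t) - (x b - x a)
          = (\<Sum>(t,k)\<in>p. measure lborel k *\<^sub>R D0 t - (x (Sup k) - x (Inf k)))"
        unfolding sum_x[symmetric] by (simp add: sum_subtractf case_prod_unfold)
      also have "\<dots> = (\<Sum>(t,k)\<in>p - B. measure lborel k *\<^sub>R D0 t - (x (Sup k) - x (Inf k)))
          + (\<Sum>(t,k)\<in>B. measure lborel k *\<^sub>R D0 t - (x (Sup k) - x (Inf k)))"
        by (rule sum.subset_diff) (use B fin in auto)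
      also have "norm \<dots> \<le> (\<Sum>(t,k)\<in>p - B. e/2 * (Sup k - Inf k))
          + (\<Sum>(t,k)\<in>B. dist (x (Inf k)) (x (Sup k)))"
      proof (rule norm_triangle_mono; rule sum_norm_le; clarify)
        fix t k assume "(t,k) \<in> p" "(t,k) \<notin> B"
        then show "norm (measure lborel k *\<^sub>R D0 t - (x (Sup k) - x (Inf k))) \<le> e/2 * (Sup k - Inf k)"
          using good[of t k] unfolding D0_def B_def by auto
      next
        fix t k assume "(t,k) \<in> B"
        then show "norm (measure lborel k *\<^sub>R D0 t - (x (Sup k) - x (Inf k))) \<le> dist (x (Inf k)) (x (Sup k))"
          unfolding D0_def B_def by (simp add: dist_norm)
      qed
      also have "(\<Sum>(t,k)\<in>p - B. e/2 * (Sup k - Inf k)) \<le> (\<Sum>(t,k)\<in>p. e/2 * (Sup k - Inf k))"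
        using fin ends \<open>e > 0\<close> by (intro sum_mono2) auto
      also have "\<dots> = e/2 * (b - a)"
        unfolding sum_len[symmetric] by (simp add: sum_distrib_left case_prod_unfold)
      finally show ?thesis using bad \<open>a < b\<close> by simp
    qed
    ultimately show "\<exists>g. gauge g \<and> (\<forall>p. p tagged_division_of cbox a b \<and> g fine p \<longrightarrow>
        norm ((\<Sum>(t, k)\<in>p. measure lborel k *\<^sub>R D0 t) - (x b - x a)) \<le> e * measure lborel (cbox a b))"
      by (intro exI[of _ g]) simp
  qed
  then show ?thesis
    by (intro has_integral_spike[OF N, of "{a..b}" D D0]) (auto simp: D0_def)
qed (use has_integral_refl(2)[of D b] in simp)

lemma bounded_derivative_imp_absolutely_continuous:
  fixes x :: "real \<Rightarrow> 'a::banach"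
  assumes cont: "continuous_on {a..b} x" and "finite E" and "0 \<le> C"
    and der: "\<And>t. t \<in> {a<..<b} - E \<Longrightarrow> (x has_vector_derivative D t) (at t)"
    and bound: "\<And>t. t \<in> {a<..<b} - E \<Longrightarrow> norm (D t) \<le> C"
  shows "absolutely_continuous_on_interval a b x"
proof (rule lipschitz_compose_absolutely_continuous[OF absolutely_continuous_on_interval_ident, of C "{a..b}"])
  have *: "norm (x t - x s) \<le> C * (t - s)" if "s \<in> {a..b}" "t \<in> {a..b}" "s \<le> t" for s t
  proof -
    have "(D has_integral (x t - x s)) (cbox s t)"
      unfolding box_real
      by (rule fundamental_theorem_of_calculus_interior_strong[OF \<open>finite E\<close> \<open>s \<le> t\<close>])
        (use that der in \<open>auto intro: continuous_on_subset[OF cont]\<close>)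
    from has_integral_bound_spike_finite[OF \<open>0 \<le> C\<close> _ this, of "E \<union> {s, t}"]
    show ?thesis using \<open>finite E\<close> bound that by auto
  qed
  show "C-lipschitz_on {a..b} x"
  proof (rule lipschitz_onI[OF _ \<open>0 \<le> C\<close>])
    fix s t assume "s \<in> {a..b}" "t \<in> {a..b}"
    then show "dist (x s) (x t) \<le> C * dist s t"
      using *[of s t] *[of t s] by (cases "s \<le> t") (auto simp: dist_norm norm_minus_commute)
  qed
qed auto

section \<open>Almost everywhere statements\<close>

text \<open>
  Null sets of the restricted measure are traded for negligible sets, the form in which
  exceptional sets enter the Henstock-Kurzweil integral.
\<close>

lemma AE_lebesgue_onE:
  assumes "AE t in lebesgue_on S. P t" "S \<in> sets lebesgue"
  obtains N where "negligible N" "\<And>t. t \<in> S - N \<Longrightarrow> P t"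
proof -
  have "AE t in lebesgue. t \<in> S \<longrightarrow> P t"
    using assms by (subst AE_restrict_space_iff[symmetric]) auto
  then obtain N where "N \<in> null_sets lebesgue" "{t \<in> space lebesgue. \<not> (t \<in> S \<longrightarrow> P t)} \<subseteq> N"
    unfolding eventually_ae_filter by blast
  then show ?thesis by (intro that[of N]) (auto simp: negligible_iff_null_sets)
qed

lemma AE_lebesgue_onI:
  assumes "negligible N" "\<And>t. t \<in> S - N \<Longrightarrow> P t" "S \<in> sets lebesgue"
  shows "AE t in lebesgue_on S. P t"
proof -
  have "AE t in lebesgue. t \<in> S \<longrightarrow> P t"
    using assms(1,2) by (intro AE_I'[of N]) (auto simp: negligible_iff_null_sets)
  then show ?thesis using assms(3) by (subst AE_restrict_space_iff) auto
qed

section \<open>Energy\<close>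

text \<open>
  An antiderivative of the force \<open>1 / q\<^sup>2 - \<sigma> q\<close> exerted under the constant control \<open>\<sigma>\<close>; in contrast
  to the sign convention of physics, kinetic energy minus potential is conserved.
\<close>

definition potential :: "real \<Rightarrow> real \<Rightarrow> real" where
  "potential \<sigma> q = - 1 / q - \<sigma> * q\<^sup>2 / 2"

lemma potential_has_derivative:
  assumes "q > 0"
  shows "(potential \<sigma> has_real_derivative 1 / q\<^sup>2 - \<sigma> * q) (at q within S)"
  unfolding potential_def
  using assms by (auto intro!: derivative_eq_intros simp: power2_eq_square field_simps)

lemma potential_diff:
  assumes "p \<noteq> 0" "q \<noteq> 0"
  shows "potential \<sigma> q - potential \<sigma> p = (q - p) * (1 / (p * q) - \<sigma> * (p + q) / 2)"
  using assms unfolding potential_def by (simp add: power2_eq_square field_simps)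

text \<open>
  The bound makes the energy along a trajectory, a Lipschitz function of an absolutely continuous
  one, absolutely continuous.
\<close>

lemma energy_lipschitz:
  assumes "\<bar>\<sigma>\<bar> \<le> 1" "B \<ge> 0" "\<gamma> \<ge> 1"
  shows "(B + 1 + \<gamma>)-lipschitz_on ({1..\<gamma>} \<times> {-B..B}) (\<lambda>p. (snd p)\<^sup>2 / 2 - potential \<sigma> (fst p))"
proof (rule lipschitz_onI)
  fix y z assume yz: "y \<in> {1..\<gamma>} \<times> {-B..B}" "z \<in> {1..\<gamma>} \<times> {-B..B}"
  obtain p v q w where y: "y = (p, v)" and z: "z = (q, w)" by force
  have pq: "1 \<le> p" "p \<le> \<gamma>" "1 \<le> q" "q \<le> \<gamma>" "-B \<le> v" "v \<le> B" "-B \<le> w" "w \<le> B"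
    using yz unfolding y z by auto
  have "\<bar>v\<^sup>2 / 2 - w\<^sup>2 / 2\<bar> = \<bar>(v + w) / 2\<bar> * \<bar>v - w\<bar>"
    unfolding abs_mult[symmetric] by (simp add: power2_eq_square field_simps)
  also have "\<dots> \<le> B * \<bar>v - w\<bar>"
    using pq by (intro mult_right_mono) auto
  finally have kin: "\<bar>v\<^sup>2 / 2 - w\<^sup>2 / 2\<bar> \<le> B * \<bar>v - w\<bar>" .
  have "0 \<le> 1 / (q * p)" "1 / (q * p) \<le> 1"
    using pq mult_mono[of 1 q 1 p] by (auto simp: field_simps)
  moreover have "\<bar>\<sigma> * (q + p) / 2\<bar> \<le> \<gamma>"
    using pq assms(1) mult_mono[of "\<bar>\<sigma>\<bar>" 1 "\<bar>q + p\<bar>" "2 * \<gamma>"] by (simp add: abs_mult)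
  ultimately have "\<bar>1 / (q * p) - \<sigma> * (q + p) / 2\<bar> \<le> 1 + \<gamma>" by linarith
  then have "\<bar>p - q\<bar> * \<bar>1 / (q * p) - \<sigma> * (q + p) / 2\<bar> \<le> \<bar>p - q\<bar> * (1 + \<gamma>)"
    by (intro mult_left_mono) auto
  moreover have "potential \<sigma> p - potential \<sigma> q = (p - q) * (1 / (q * p) - \<sigma> * (q + p) / 2)"
    using pq by (intro potential_diff) auto
  ultimately have pot: "\<bar>potential \<sigma> p - potential \<sigma> q\<bar> \<le> (1 + \<gamma>) * \<bar>p - q\<bar>"
    by (simp add: abs_mult mult.commute)
  have "\<bar>p - q\<bar> \<le> dist y z" "\<bar>v - w\<bar> \<le> dist y z"
    using dist_fst_le[of y z] dist_snd_le[of y z] unfolding y z by (auto simp: dist_real_def)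
  then have "B * \<bar>v - w\<bar> + (1 + \<gamma>) * \<bar>p - q\<bar> \<le> B * dist y z + (1 + \<gamma>) * dist y z"
    using assms by (intro add_mono mult_left_mono) auto
  with kin pot show "dist ((snd y)\<^sup>2 / 2 - potential \<sigma> (fst y)) ((snd z)\<^sup>2 / 2 - potential \<sigma> (fst z))
      \<le> (B + 1 + \<gamma>) * dist y z"
    by (simp add: y z dist_real_def algebra_simps)
qed (use assms in simp)

section \<open>Trajectories of a feasible process\<close>

locale feasible_process =
  fixes \<gamma> T :: real and u :: "real \<Rightarrow> real" and x :: "real \<Rightarrow> real \<times> real"
  assumes feasible: "feasible \<gamma> T u x"
begin

abbreviation "pos t \<equiv> fst (x t)"
abbreviation "vel t \<equiv> snd (x t)"

lemma T_nonneg: "0 \<le> T" and initial: "x 0 = (1, 0)" and final: "x T = (\<gamma>, 0)"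
  using feasible unfolding feasible_def by auto

lemma absolutely_continuous: "absolutely_continuous_on_interval 0 T x"
  and in_state_space: "\<And>t. t \<in> {0..T} \<Longrightarrow> x t \<in> state_space"
  using feasible unfolding feasible_def trajectory_def solution_def by auto

lemma pos_pos: "t \<in> {0..T} \<Longrightarrow> 0 < pos t" and vel_nonneg: "t \<in> {0..T} \<Longrightarrow> 0 \<le> vel t"
  using in_state_space unfolding state_space_def by auto

lemma continuous_x: "continuous_on {0..T} x"
  by (rule absolutely_continuous_on_interval_imp_continuous_on[OF absolutely_continuous])

text \<open>
  One null set off which both the control constraint and the equation of motion hold. Fixing it
  here lets the facts below refer to the same set.
\<close>

definition exceptional :: "real set" where
  "exceptional = (SOME N. negligible N \<and> (\<forall>t\<in>{0..T} - N. - 1 \<le> u t \<and> u t \<le> 1 \<and>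
     (x has_vector_derivative (vel t, 1 / (pos t)\<^sup>2 - u t * pos t)) (at t within {0..T})))"

lemma exceptional:
  shows negligible_exceptional: "negligible exceptional"
    and control_bounds: "\<And>t. t \<in> {0..T} - exceptional \<Longrightarrow> - 1 \<le> u t \<and> u t \<le> 1"
    and equation: "\<And>t. t \<in> {0..T} - exceptional \<Longrightarrow>
      (x has_vector_derivative (vel t, 1 / (pos t)\<^sup>2 - u t * pos t)) (at t within {0..T})"
proof -
  have "AE t in lebesgue_on {0..T}. - 1 \<le> u t \<and> u t \<le> 1"
    using feasible unfolding feasible_def admissible_control_def by auto
  then obtain N1 where N1: "negligible N1" "\<And>t. t \<in> {0..T} - N1 \<Longrightarrow> - 1 \<le> u t \<and> u t \<le> 1"
    by (rule AE_lebesgue_onE) auto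
  have "AE t in lebesgue_on {0..T}.
      (x has_vector_derivative (f_field (x t) + u t *\<^sub>R g_field (x t))) (at t within {0..T})"
    using feasible unfolding feasible_def trajectory_def solution_def by auto
  then obtain N2 where N2: "negligible N2" "\<And>t. t \<in> {0..T} - N2 \<Longrightarrow>
      (x has_vector_derivative (f_field (x t) + u t *\<^sub>R g_field (x t))) (at t within {0..T})"
    by (rule AE_lebesgue_onE) auto
  have "f_field (x t) + u t *\<^sub>R g_field (x t) = (vel t, 1 / (pos t)\<^sup>2 - u t * pos t)" for t
    unfolding f_field_def g_field_def by simp
  then have "negligible (N1 \<union> N2) \<and> (\<forall>t\<in>{0..T} - (N1 \<union> N2). - 1 \<le> u t \<and> u t \<le> 1 \<and>
     (x has_vector_derivative (vel t, 1 / (pos t)\<^sup>2 - u t * pos t)) (at t within {0..T}))"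
    using N1 N2 by auto
  then have *: "negligible exceptional \<and> (\<forall>t\<in>{0..T} - exceptional. - 1 \<le> u t \<and> u t \<le> 1 \<and>
     (x has_vector_derivative (vel t, 1 / (pos t)\<^sup>2 - u t * pos t)) (at t within {0..T}))"
    unfolding exceptional_def by (rule someI)
  then show "negligible exceptional"
    "\<And>t. t \<in> {0..T} - exceptional \<Longrightarrow> - 1 \<le> u t \<and> u t \<le> 1"
    "\<And>t. t \<in> {0..T} - exceptional \<Longrightarrow>
      (x has_vector_derivative (vel t, 1 / (pos t)\<^sup>2 - u t * pos t)) (at t within {0..T})"
    by auto
qed

lemma vel_has_integral:
  assumes "0 \<le> c" "c \<le> d" "d \<le> T"
  shows "(vel has_integral (pos d - pos c)) {c..d}"
proof (rule has_integral_derivative_absolutely_continuous[OF \<open>c \<le> d\<close> _ negligible_exceptional])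
  have "1-lipschitz_on UNIV (fst :: real \<times> real \<Rightarrow> real)"
    by (intro lipschitz_onI) (auto simp: dist_fst_le)
  then have "absolutely_continuous_on_interval 0 T pos"
    by (rule lipschitz_compose_absolutely_continuous[OF absolutely_continuous]) auto
  then show "absolutely_continuous_on_interval c d pos"
    by (rule absolutely_continuous_on_interval_subset) (use assms in auto)
  fix t assume "t \<in> {c..d} - exceptional"
  then have "(x has_vector_derivative (vel t, 1 / (pos t)\<^sup>2 - u t * pos t)) (at t within {c..d})"
    using assms by (intro has_vector_derivative_within_subset[OF equation]) auto
  from bounded_linear.has_vector_derivative[OF bounded_linear_fst this]
  show "(pos has_vector_derivative vel t) (at t within {c..d})" by simp
qed

lemma pos_mono:
  assumes "0 \<le> c" "c \<le> d" "d \<le> T"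
  shows "pos c \<le> pos d"
  using has_integral_nonneg[OF vel_has_integral[OF assms]] vel_nonneg assms by auto

lemma pos_range: "t \<in> {0..T} \<Longrightarrow> pos t \<in> {1..\<gamma>}"
  using pos_mono[of 0 t] pos_mono[of t T] initial final by auto

text \<open>
  Position is the integral of the continuous function \<open>vel\<close>, hence differentiable at every time,
  whereas velocity is differentiable almost everywhere only.
\<close>

lemma pos_has_derivative:
  assumes "t \<in> {0..T}"
  shows "(pos has_real_derivative vel t) (at t within {0..T})"
proof -
  have "((\<lambda>s. 1 + integral {0..s} vel) has_real_derivative vel t) (at t within {0..T})"
    using integral_has_real_derivative[of 0 T vel t] continuous_x assms
    by (auto intro!: derivative_eq_intros continuous_intros)
  moreover have "1 + integral {0..s} vel = pos s" if "s \<in> {0..T}" for s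
    using vel_has_integral[of 0 s] that initial by (auto dest: integral_unique)
  ultimately show ?thesis
    using assms by (auto intro: has_field_derivative_transform_within[OF _ zero_less_one])
qed

text \<open>
  The part of the force that derives from the potential cancels, and only the deviation of the
  control from \<open>\<sigma>\<close> does work.
\<close>

lemma energy_has_derivative:
  assumes t: "t \<in> {0..T} - exceptional"
  shows "((\<lambda>t. (vel t)\<^sup>2 / 2 - potential \<sigma> (pos t)) has_real_derivative
      (\<sigma> - u t) * pos t * vel t) (at t within {0..T})"
proof -
  from bounded_linear.has_vector_derivative[OF bounded_linear_snd equation[OF t]]
  have vel': "(vel has_real_derivative 1 / (pos t)\<^sup>2 - u t * pos t) (at t within {0..T})"
    by (simp add: has_real_derivative_iff_has_vector_derivative)
  have "((\<lambda>t. potential \<sigma> (pos t)) has_real_derivative (1 / (pos t)\<^sup>2 - \<sigma> * pos t) * vel t) (at t within {0..T})"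
    using t by (intro DERIV_chain2[OF potential_has_derivative] pos_has_derivative pos_pos) auto
  from DERIV_diff[OF DERIV_cdivide[OF DERIV_power[OF vel', of 2], of 2] this]
  show ?thesis
    by (rule DERIV_cong) (simp add: algebra_simps add_divide_distrib diff_divide_distrib)
qed

lemma energy_has_integral:
  assumes "0 \<le> c" "c \<le> d" "d \<le> T" "\<bar>\<sigma>\<bar> \<le> 1"
  shows "((\<lambda>t. (\<sigma> - u t) * pos t * vel t) has_integral
      ((vel d)\<^sup>2 / 2 - potential \<sigma> (pos d) - ((vel c)\<^sup>2 / 2 - potential \<sigma> (pos c)))) {c..d}"
proof (rule has_integral_derivative_absolutely_continuous[OF \<open>c \<le> d\<close> _ negligible_exceptional])
  have "\<gamma> \<ge> 1" using pos_range[of T] final T_nonneg by auto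
  have "compact (vel ` {0..T})"
    by (intro compact_continuous_image continuous_intros continuous_x) auto
  then have "bounded (vel ` {0..T})" by (rule compact_imp_bounded)
  then obtain B where "\<forall>v\<in>vel ` {0..T}. norm v \<le> B" unfolding bounded_iff ..
  then have B: "\<bar>vel t\<bar> \<le> B" if "t \<in> {0..T}" for t using that by auto
  have "B \<ge> 0" using B[of 0] T_nonneg by auto
  have "absolutely_continuous_on_interval 0 T (\<lambda>t. (vel t)\<^sup>2 / 2 - potential \<sigma> (pos t))"
  proof (rule lipschitz_compose_absolutely_continuous[OF absolutely_continuous
        energy_lipschitz[OF \<open>\<bar>\<sigma>\<bar> \<le> 1\<close> \<open>B \<ge> 0\<close> \<open>\<gamma> \<ge> 1\<close>]])
    show "x ` {0..T} \<subseteq> {1..\<gamma>} \<times> {- B..B}"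
    proof clarify
      fix t q v assume "t \<in> {0..T}" "(q, v) = x t"
      then show "q \<in> {1..\<gamma>} \<and> v \<in> {- B..B}"
        using B[of t] pos_range[of t] by (metis abs_le_iff atLeastAtMost_iff fst_conv minus_le_iff snd_conv)
    qed
  qed
  then show "absolutely_continuous_on_interval c d (\<lambda>t. (vel t)\<^sup>2 / 2 - potential \<sigma> (pos t))"
    by (rule absolutely_continuous_on_interval_subset) (use assms in auto)
  fix t assume "t \<in> {c..d} - exceptional"
  then show "((\<lambda>t. (vel t)\<^sup>2 / 2 - potential \<sigma> (pos t)) has_vector_derivative
      (\<sigma> - u t) * pos t * vel t) (at t within {c..d})"
    using assms unfolding has_real_derivative_iff_has_vector_derivative[symmetric]
    by (intro DERIV_subset[OF energy_has_derivative]) auto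
qed

text \<open>
  Energies are compared with the initial point for \<open>\<sigma> = - 1\<close> and with the final point for
  \<open>\<sigma> = 1\<close>, where the kinetic energy vanishes. The state constraint enters through the factor \<open>vel\<close>
  in the derivative of the energy, which it makes of constant sign.
\<close>

lemma speed_bounds:
  assumes t: "t \<in> {0..T}"
  shows "(vel t)\<^sup>2 / 2 \<le> potential (-1) (pos t) - potential (-1) 1"
    and "(vel t)\<^sup>2 / 2 \<le> potential 1 (pos t) - potential 1 \<gamma>"
proof -
  have sign: "0 \<le> (1 + u s) * pos s * vel s \<and> 0 \<le> (1 - u s) * pos s * vel s"
    if "s \<in> {0..T} - exceptional" for s
    using control_bounds[OF that] pos_pos[of s] vel_nonneg[of s] that by auto
  have "0 \<le> - ((vel t)\<^sup>2 / 2 - potential (-1) (pos t) - ((vel 0)\<^sup>2 / 2 - potential (-1) (pos 0)))"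
  proof (rule has_integral_nonneg)
    show "((\<lambda>s. if s \<in> exceptional then 0 else (1 + u s) * pos s * vel s) has_integral
      - ((vel t)\<^sup>2 / 2 - potential (-1) (pos t) - ((vel 0)\<^sup>2 / 2 - potential (-1) (pos 0)))) {0..t}"
      by (rule has_integral_spike[OF negligible_exceptional _
          has_integral_neg[OF energy_has_integral[of 0 t "-1"]]])
        (use t in \<open>auto simp: algebra_simps\<close>)
  qed (use sign t in auto)
  then show "(vel t)\<^sup>2 / 2 \<le> potential (-1) (pos t) - potential (-1) 1" using initial by simp
  have "0 \<le> (vel T)\<^sup>2 / 2 - potential 1 (pos T) - ((vel t)\<^sup>2 / 2 - potential 1 (pos t))"
  proof (rule has_integral_nonneg)
    show "((\<lambda>s. if s \<in> exceptional then 0 else (1 - u s) * pos s * vel s) has_integral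
      (vel T)\<^sup>2 / 2 - potential 1 (pos T) - ((vel t)\<^sup>2 / 2 - potential 1 (pos t))) {t..T}"
      by (rule has_integral_spike[OF negligible_exceptional _ energy_has_integral[of t T 1]])
        (use t in auto)
  qed (use sign t in auto)
  then show "(vel t)\<^sup>2 / 2 \<le> potential 1 (pos t) - potential 1 \<gamma>" using final by simp
qed

lemma form_XY_if_control_switches:
  assumes t1: "0 < t1" "t1 < T"
    and before: "AE t in lebesgue_on {0<..<t1}. u t = - 1"
    and after: "AE t in lebesgue_on {t1<..<T}. u t = 1"
  shows "form_XY T u x"
proof -
  have const: "solution (\<lambda>t p. f_field p + \<sigma> *\<^sub>R g_field p) c d x"
    if cd: "0 \<le> c" "d \<le> T" and \<sigma>: "AE t in lebesgue_on {c<..<d}. u t = \<sigma>" for c d \<sigma>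
  proof -
    obtain N where N: "negligible N" "\<And>t. t \<in> {c<..<d} - N \<Longrightarrow> u t = \<sigma>"
      using \<sigma> by (rule AE_lebesgue_onE) auto
    have "AE t in lebesgue_on {c..d}.
        (x has_vector_derivative (f_field (x t) + \<sigma> *\<^sub>R g_field (x t))) (at t within {c..d})"
    proof (rule AE_lebesgue_onI)
      show "negligible (exceptional \<union> N \<union> {c, d})"
        using N negligible_exceptional by (auto intro!: negligible_Un)
      fix t assume t: "t \<in> {c..d} - (exceptional \<union> N \<union> {c, d})"
      then have "u t = \<sigma>" using N by auto
      moreover have "t \<in> {0..T} - exceptional" using t cd by auto
      ultimately have "(x has_vector_derivative (f_field (x t) + \<sigma> *\<^sub>R g_field (x t))) (at t within {0..T})"
        using equation[of t] by (simp add: f_field_def g_field_def)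
      then show "(x has_vector_derivative (f_field (x t) + \<sigma> *\<^sub>R g_field (x t))) (at t within {c..d})"
        by (rule has_vector_derivative_within_subset) (use cd in auto)
    qed auto
    moreover have "absolutely_continuous_on_interval c d x"
      by (rule absolutely_continuous_on_interval_subset[OF absolutely_continuous]) (use cd in auto)
    moreover have "\<forall>t\<in>{c..d}. x t \<in> state_space"
      using in_state_space cd by auto
    ultimately show ?thesis unfolding solution_def by blast
  qed
  have "X_trajectory 0 t1 x"
    using const[of 0 t1 "-1"] t1 before unfolding X_trajectory_def by simp
  moreover have "Y_trajectory t1 T x"
    using const[of t1 T 1] t1 after unfolding Y_trajectory_def by simp
  ultimately show ?thesis unfolding form_XY_def using assms by blast
qed

end

section \<open>The fastest speed profile\<close>

text \<open>
  The first term is the kinetic energy on the \<open>X\<close>-trajectory that starts at \<open>(1, 0)\<close>, the second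
  the one on the \<open>Y\<close>-trajectory that ends at \<open>(\<gamma>, 0)\<close>.
\<close>

definition max_kinetic :: "real \<Rightarrow> real \<Rightarrow> real" where
  "max_kinetic \<gamma> q = min (potential (-1) q - potential (-1) 1) (potential 1 q - potential 1 \<gamma>)"

text \<open>
  The position at which both arcs have the same speed: the difference of the two kinetic energies
  is \<open>q\<^sup>2 - \<gamma>\<^sup>2 / 2 - 1 / \<gamma> + 1 / 2\<close>.
\<close>

definition switch_point :: "real \<Rightarrow> real" where
  "switch_point \<gamma> = sqrt (\<gamma>\<^sup>2 / 2 + 1 / \<gamma> - 1 / 2)"

definition pace :: "real \<Rightarrow> real \<Rightarrow> real" where
  "pace \<gamma> q = 1 / sqrt (2 * max_kinetic \<gamma> q)"

definition travel_time :: "real \<Rightarrow> real \<Rightarrow> real" where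
  "travel_time \<gamma> q = integral {1..q} (pace \<gamma>)"

text \<open>
  A lower bound on \<open>1 \<le> q \<le> \<gamma>\<close> for the slope of the secants of \<open>- potential 1\<close> between \<open>q\<close> and
  \<open>\<gamma>\<close>.
\<close>

definition slope :: "real \<Rightarrow> real" where
  "slope \<gamma> = (\<gamma> + 1) / 2 - 1 / \<gamma>"

context
  fixes \<gamma> :: real
  assumes gamma: "\<gamma> > 1"
begin

lemma switch_point_square: "(switch_point \<gamma>)\<^sup>2 = \<gamma>\<^sup>2 / 2 + 1 / \<gamma> - 1 / 2"
proof -
  have "\<gamma>\<^sup>2 \<ge> 1" using gamma by (simp add: one_le_power)
  moreover have "1 / \<gamma> \<ge> 0" using gamma by simp
  ultimately show ?thesis unfolding switch_point_def by (intro real_sqrt_pow2) linarith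
qed

lemma switch_point_bounds: "1 < switch_point \<gamma>" "switch_point \<gamma> < \<gamma>"
proof -
  \<comment> \<open>The factorization \<open>\<gamma>^3 - 3 \<gamma> + 2 = (\<gamma> - 1)^2 (\<gamma> + 2)\<close>.\<close>
  have "0 < (\<gamma> - 1)\<^sup>2 * (\<gamma> + 2) / (2 * \<gamma>)" using gamma by (intro divide_pos_pos mult_pos_pos) auto
  also have "\<dots> = \<gamma>\<^sup>2 / 2 + 1 / \<gamma> - 1 / 2 - 1"
    using gamma by (simp add: field_simps power2_eq_square)
  finally show "1 < switch_point \<gamma>" unfolding switch_point_def by simp
  have "1 / \<gamma> < 1" "1 < \<gamma>\<^sup>2" using gamma by (auto simp: power2_eq_square intro: less_1_mult)
  then have "(switch_point \<gamma>)\<^sup>2 < \<gamma>\<^sup>2" unfolding switch_point_square by linarith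
  then show "switch_point \<gamma> < \<gamma>" by (rule power_less_imp_less_base) (use gamma in simp)
qed

lemma max_kinetic_before_switch:
  assumes "0 \<le> q" "q \<le> switch_point \<gamma>"
  shows "max_kinetic \<gamma> q = potential (-1) q - potential (-1) 1"
  using power_mono[OF assms(2,1), of 2] gamma
  unfolding max_kinetic_def switch_point_square potential_def by (simp add: field_simps)

lemma max_kinetic_after_switch:
  assumes "switch_point \<gamma> \<le> q"
  shows "max_kinetic \<gamma> q = potential 1 q - potential 1 \<gamma>"
  using power_mono[OF assms, of 2] switch_point_bounds gamma
  unfolding max_kinetic_def switch_point_square potential_def by (simp add: field_simps)

lemma slope_pos: "slope \<gamma> > 0"
proof -
  have "1 / \<gamma> < 1" "1 < (\<gamma> + 1) / 2" using gamma by auto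
  then show ?thesis unfolding slope_def by linarith
qed

text \<open>
  At both ends the maximal kinetic energy vanishes only to first order. Hence the reciprocal of the
  speed has singularities of the order of an inverse square root, which are integrable.
\<close>

lemma max_kinetic_lower:
  assumes "1 \<le> q" "q \<le> \<gamma>"
  shows "min (q - 1) (slope \<gamma> * (\<gamma> - q)) \<le> max_kinetic \<gamma> q"
proof -
  have "potential (-1) q - potential (-1) 1 = (q - 1) * (1 / q + (1 + q) / 2)"
    using potential_diff[of 1 q "-1"] assms by (auto simp: field_simps)
  moreover have "0 \<le> 1 / q" "1 \<le> (1 + q) / 2" using assms by auto
  then have "1 / q + (1 + q) / 2 \<ge> 1" by linarith
  ultimately have "q - 1 \<le> potential (-1) q - potential (-1) 1"
    using assms mult_left_mono[of 1 "1 / q + (1 + q) / 2" "q - 1"] by simp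
  moreover have "slope \<gamma> * (\<gamma> - q) \<le> potential 1 q - potential 1 \<gamma>"
  proof -
    have "1 / (\<gamma> * q) \<le> 1 / \<gamma>" using assms gamma by (simp add: field_simps)
    moreover have "(\<gamma> + 1) / 2 \<le> (\<gamma> + q) / 2" using assms by simp
    ultimately have "slope \<gamma> \<le> (\<gamma> + q) / 2 - 1 / (\<gamma> * q)" unfolding slope_def by linarith
    then have "slope \<gamma> * (\<gamma> - q) \<le> ((\<gamma> + q) / 2 - 1 / (\<gamma> * q)) * (\<gamma> - q)"
      using assms by (intro mult_right_mono) auto
    also have "\<dots> = potential 1 q - potential 1 \<gamma>"
    proof -
      have "((\<gamma> + q) / 2 - r) * (\<gamma> - q) = (q - \<gamma>) * (r - 1 * (\<gamma> + q) / 2)" for r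
        by (simp add: field_simps)
      then show ?thesis using potential_diff[of \<gamma> q 1] assms gamma by simp
    qed
    finally show ?thesis .
  qed
  ultimately show ?thesis unfolding max_kinetic_def by (simp add: min_le_iff_disj)
qed

lemma max_kinetic_pos: "max_kinetic \<gamma> q > 0" if "1 < q" "q < \<gamma>"
  using max_kinetic_lower[of q] that slope_pos by (smt (verit) mult_pos_pos)

lemma max_kinetic_nonneg: "max_kinetic \<gamma> q \<ge> 0" if "1 \<le> q" "q \<le> \<gamma>"
  using max_kinetic_lower[of q] that slope_pos by (smt (verit) mult_nonneg_nonneg)

lemma max_kinetic_ends: "max_kinetic \<gamma> 1 = 0" "max_kinetic \<gamma> \<gamma> = 0"
  using max_kinetic_before_switch[of 1] max_kinetic_after_switch[of \<gamma>] switch_point_bounds by auto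

lemma continuous_max_kinetic: "continuous_on {0<..} (max_kinetic \<gamma>)"
  unfolding max_kinetic_def potential_def by (intro continuous_intros) auto

lemma pace_nonneg: "1 \<le> q \<Longrightarrow> q \<le> \<gamma> \<Longrightarrow> pace \<gamma> q \<ge> 0"
  unfolding pace_def using max_kinetic_nonneg by simp

lemma pace_pos: "1 < q \<Longrightarrow> q < \<gamma> \<Longrightarrow> pace \<gamma> q > 0"
  unfolding pace_def using max_kinetic_pos by simp

lemma pace_upper:
  assumes "1 \<le> q" "q \<le> \<gamma>"
  shows "pace \<gamma> q \<le> 1 / sqrt (q - 1) + (1 / sqrt (slope \<gamma>)) * (1 / sqrt (\<gamma> - q))"
proof (cases "q = 1 \<or> q = \<gamma>")
  case True
  \<comment> \<open>Here the speed is 0 and the pace is 0 as well, by the convention for division by 0.\<close>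
  then show ?thesis
    unfolding pace_def using max_kinetic_ends gamma slope_pos by auto
next
  case False
  then have q: "1 < q" "q < \<gamma>" using assms by auto
  define k where "k = max_kinetic \<gamma> q"
  have k: "k > 0" unfolding k_def using max_kinetic_pos q by simp
  have *: "1 / sqrt (2 * k) \<le> 1 / sqrt w" if "0 < w" "w \<le> k" for w
    using that k by (intro divide_left_mono mult_pos_pos) auto
  have nonneg: "0 \<le> 1 / sqrt (q - 1)" "0 \<le> 1 / sqrt (slope \<gamma> * (\<gamma> - q))"
    using q slope_pos by auto
  have "1 / sqrt (2 * k) \<le> 1 / sqrt (q - 1) + 1 / sqrt (slope \<gamma> * (\<gamma> - q))"
    using max_kinetic_lower[OF assms] *[of "q - 1"] *[of "slope \<gamma> * (\<gamma> - q)"] nonneg q slope_pos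
    unfolding k_def[symmetric] min_le_iff_disj by (smt (verit) mult_pos_pos)
  then show ?thesis unfolding pace_def k_def by (simp add: real_sqrt_mult)
qed

lemma pace_integrable: "pace \<gamma> integrable_on {1..\<gamma>}"
proof (rule measurable_bounded_by_integrable_imp_integrable)
  have "pace \<gamma> \<in> borel_measurable borel"
    unfolding pace_def[abs_def] max_kinetic_def potential_def by measurable
  then show "pace \<gamma> \<in> borel_measurable (lebesgue_on {1..\<gamma>})"
    by (intro measurable_restrict_space1 measurable_completion) simp
  have "((\<lambda>q. 1 / sqrt (q - 1)) has_integral 2 * sqrt (\<gamma> - 1) - 2 * sqrt (1 - 1)) {1..\<gamma>}"
    using gamma unfolding has_real_derivative_iff_has_vector_derivative
    by (intro fundamental_theorem_of_calculus_interior)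
      (auto intro!: continuous_intros derivative_eq_intros
        simp: has_real_derivative_iff_has_vector_derivative[symmetric] field_simps)
  moreover have "((\<lambda>q. 1 / sqrt (\<gamma> - q)) has_integral (- 2 * sqrt (\<gamma> - \<gamma>)) - (- 2 * sqrt (\<gamma> - 1))) {1..\<gamma>}"
    using gamma
    by (intro fundamental_theorem_of_calculus_interior)
      (auto intro!: continuous_intros derivative_eq_intros
        simp: has_real_derivative_iff_has_vector_derivative[symmetric] field_simps)
  ultimately show "(\<lambda>q. 1 / sqrt (q - 1) + (1 / sqrt (slope \<gamma>)) * (1 / sqrt (\<gamma> - q))) integrable_on {1..\<gamma>}"
    by (intro integrable_add integrable_on_mult_right) (auto simp only: integrable_on_def)
  show "norm (pace \<gamma> q) \<le> 1 / sqrt (q - 1) + (1 / sqrt (slope \<gamma>)) * (1 / sqrt (\<gamma> - q))" if "q \<in> {1..\<gamma>}" for q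
    using pace_upper[of q] pace_nonneg[of q] that by simp
qed simp

lemma continuous_travel_time: "continuous_on {1..\<gamma>} (travel_time \<gamma>)"
  unfolding travel_time_def[abs_def] by (rule indefinite_integral_continuous_1[OF pace_integrable])

lemma travel_time_has_derivative:
  assumes "1 < q" "q < \<gamma>"
  shows "(travel_time \<gamma> has_real_derivative pace \<gamma> q) (at q)"
proof -
  have "isCont (max_kinetic \<gamma>) q"
    using continuous_max_kinetic assms by (simp add: continuous_on_eq_continuous_at)
  then have "isCont (pace \<gamma>) q"
    unfolding pace_def[abs_def] using max_kinetic_pos[OF assms] by (intro continuous_intros) auto
  then have "((\<lambda>u. integral {1..u} (pace \<gamma>)) has_vector_derivative pace \<gamma> q) (at q within ({1..\<gamma>} - {}))"
    using assms by (intro integral_has_vector_derivative_continuous_at[OF pace_integrable])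
      (auto intro: continuous_at_imp_continuous_at_within)
  then show ?thesis
    using assms at_within_Icc_at[of 1 q \<gamma>]
    by (simp add: travel_time_def[abs_def] has_real_derivative_iff_has_vector_derivative)
qed

lemma travel_time_strict_mono: "strict_mono_on {1..\<gamma>} (travel_time \<gamma>)"
proof (rule strict_mono_onI)
  fix p q assume pq: "p \<in> {1..\<gamma>}" "q \<in> {1..\<gamma>}" "p < q"
  show "travel_time \<gamma> p < travel_time \<gamma> q"
  proof (rule DERIV_pos_imp_increasing_open[OF \<open>p < q\<close>])
    fix r assume "p < r" "r < q"
    then have "1 < r" "r < \<gamma>" using pq by auto
    then show "\<exists>y. (travel_time \<gamma> has_real_derivative y) (at r) \<and> 0 < y"
      using travel_time_has_derivative pace_pos by blast
  next
    show "continuous_on {p..q} (travel_time \<gamma>)"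
      by (rule continuous_on_subset[OF continuous_travel_time]) (use pq in auto)
  qed
qed

lemma travel_time_1: "travel_time \<gamma> 1 = 0"
  unfolding travel_time_def by simp

lemma travel_time_less_iff:
  "p \<in> {1..\<gamma>} \<Longrightarrow> q \<in> {1..\<gamma>} \<Longrightarrow> travel_time \<gamma> p < travel_time \<gamma> q \<longleftrightarrow> p < q"
  by (rule strict_mono_on_less[OF travel_time_strict_mono])

text \<open>
  The speed bound gives \<open>travel_time\<close> along the trajectory a rate of at most \<open>1\<close>. Since the pace is
  singular at both ends, the argument is confined to the time interval \<open>{a..b}\<close> between leaving
  \<open>1\<close> and first reaching \<open>\<gamma>\<close>; a trajectory that waits outside of it only loses time.
\<close>

lemma feasible_time_lower_bound:
  assumes "feasible \<gamma> T u x"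
  shows "travel_time \<gamma> \<gamma> \<le> T"
    and "T = travel_time \<gamma> \<gamma> \<Longrightarrow> t \<in> {0..T} \<Longrightarrow> travel_time \<gamma> (fst (x t)) = t"
proof -
  interpret feasible_process \<gamma> T u x by unfold_locales fact
  have cont: "continuous_on {0..T} pos" by (intro continuous_intros continuous_x)
  have closed: "closed {t \<in> {0..T}. pos t = c}" for c
    using continuous_closed_preimage_constant[OF cont, of c] by simp
  have compact: "compact {t \<in> {0..T}. pos t = c}" for c
    unfolding compact_eq_bounded_closed
    by (intro conjI bounded_subset[OF bounded_closed_interval[of 0 T]]) (use closed in auto)
  have "0 \<in> {t \<in> {0..T}. pos t = 1}" using T_nonneg initial by simp
  then obtain a where a: "a \<in> {0..T}" "pos a = 1" and a_max: "\<And>t. t \<in> {0..T} \<Longrightarrow> pos t = 1 \<Longrightarrow> t \<le> a"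
    using compact_attains_sup[OF compact[of 1]] by blast
  have "T \<in> {t \<in> {0..T}. pos t = \<gamma>}" using T_nonneg final by simp
  then obtain b where b: "b \<in> {0..T}" "pos b = \<gamma>" and b_min: "\<And>t. t \<in> {0..T} \<Longrightarrow> pos t = \<gamma> \<Longrightarrow> b \<le> t"
    using compact_attains_inf[OF compact[of \<gamma>]] by blast
  have "a < b" using pos_mono[of b a] a b gamma by (auto simp: not_less[symmetric])
  have range: "1 < pos t \<and> pos t < \<gamma>" if "a < t" "t < b" for t
    using pos_range[of t] a_max[of t] b_min[of t] that a(1) b(1) by force
  have mono: "c - travel_time \<gamma> (pos c) \<le> d - travel_time \<gamma> (pos d)"
    if "a \<le> c" "c \<le> d" "d \<le> b" for c d
  proof (rule DERIV_nonneg_imp_increasing_open[OF \<open>c \<le> d\<close>])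
    fix t assume t: "c < t" "t < d"
    then have t': "t \<in> {0..T}" "0 < t" "t < T" "a < t" "t < b" using that a b by auto
    then have r: "1 < pos t" "pos t < \<gamma>" using range by auto
    have "(pos has_real_derivative vel t) (at t)"
      using pos_has_derivative[OF t'(1)] at_within_Icc_at[of 0 t T] t' by simp
    then have "((\<lambda>t. t - travel_time \<gamma> (pos t)) has_real_derivative 1 - pace \<gamma> (pos t) * vel t) (at t)"
      by (intro DERIV_diff DERIV_ident travel_time_has_derivative r
          DERIV_chain2[where f = "travel_time \<gamma>" and g = pos])
    moreover have "vel t \<le> sqrt (2 * max_kinetic \<gamma> (pos t))"
      using speed_bounds[OF t'(1)] unfolding max_kinetic_def
      by (intro real_le_rsqrt) (simp add: min_def)
    then have "pace \<gamma> (pos t) * vel t \<le> 1"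
      using max_kinetic_pos[OF r] unfolding pace_def by (simp add: field_simps)
    ultimately show "\<exists>y. ((\<lambda>t. t - travel_time \<gamma> (pos t)) has_real_derivative y) (at t) \<and> 0 \<le> y"
      by (intro exI[of _ "1 - pace \<gamma> (pos t) * vel t"]) simp
  next
    have "continuous_on {0..T} (\<lambda>t. travel_time \<gamma> (pos t))"
      using pos_range by (intro continuous_on_compose2[OF continuous_travel_time cont]) blast
    then show "continuous_on {c..d} (\<lambda>t. t - travel_time \<gamma> (pos t))"
      by (intro continuous_intros) (rule continuous_on_subset, use that a b in auto)
  qed
  have "travel_time \<gamma> \<gamma> \<le> b - a" using mono[of a b] \<open>a < b\<close> a b travel_time_1 by simp
  then show "travel_time \<gamma> \<gamma> \<le> T" using a b by simp
  assume T: "T = travel_time \<gamma> \<gamma>" and t: "t \<in> {0..T}"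
  then have "a = 0" "b = T" using \<open>travel_time \<gamma> \<gamma> \<le> b - a\<close> a b by auto
  then show "travel_time \<gamma> (fst (x t)) = t"
    using mono[of 0 t] mono[of t T] t a b T travel_time_1 by auto
qed

text \<open>
  With equality in the time bound, position as a function of time is the inverse of \<open>travel_time\<close>,
  so the speed is the maximal one and one of the two energies is locally constant. Its derivative
  \<open>(\<sigma> - u) pos vel\<close> then vanishes, while \<open>pos\<close> and \<open>vel\<close> are positive.
\<close>

lemma minimal_time_imp_form_XY:
  assumes feas: "feasible \<gamma> T u x" and T: "T = travel_time \<gamma> \<gamma>"
  shows "form_XY T u x"
proof -
  interpret feasible_process \<gamma> T u x by unfold_locales fact
  define t1 where "t1 = travel_time \<gamma> (switch_point \<gamma>)"
  have t1: "0 < t1" "t1 < T"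
    using travel_time_less_iff[of 1 "switch_point \<gamma>"] travel_time_less_iff[of "switch_point \<gamma>" \<gamma>]
      switch_point_bounds travel_time_1 gamma unfolding t1_def T by auto
  have time: "travel_time \<gamma> (pos t) = t" if "t \<in> {0..T}" for t
    using feasible_time_lower_bound(2)[OF feas T that] .
  have range: "1 < pos t \<and> pos t < \<gamma>" if "0 < t" "t < T" for t
    using time[of t] pos_range[of t] travel_time_1 T that by (smt (verit) atLeastAtMost_iff)
  have pos': "(pos has_real_derivative vel t) (at t)" if "0 < t" "t < T" for t
    using pos_has_derivative[of t] at_within_Icc_at[of 0 t T] that by simp
  have speed: "vel t = sqrt (2 * max_kinetic \<gamma> (pos t))" if t: "0 < t" "t < T" for t
  proof -
    have r: "1 < pos t" "pos t < \<gamma>" using range[OF t] by auto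
    have "((\<lambda>t. travel_time \<gamma> (pos t)) has_real_derivative pace \<gamma> (pos t) * vel t) (at t)"
      by (intro DERIV_chain2[where f = "travel_time \<gamma>" and g = pos]
          travel_time_has_derivative r pos' t)
    moreover have "((\<lambda>t. travel_time \<gamma> (pos t)) has_real_derivative 1) (at t)"
      by (rule has_field_derivative_transform_within_open[OF DERIV_ident, of "{0<..<T}"])
        (use t time in auto)
    ultimately have "pace \<gamma> (pos t) * vel t = 1" by (rule DERIV_unique)
    then show ?thesis using max_kinetic_pos[OF r] unfolding pace_def by (simp add: field_simps)
  qed
  have control: "u t = \<sigma>"
    if t: "c < t" "t < d" "t \<notin> exceptional" and cd: "0 \<le> c" "d \<le> T"
      and energy: "\<And>s. c < s \<Longrightarrow> s < d \<Longrightarrow> (vel s)\<^sup>2 / 2 - potential \<sigma> (pos s) = C"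
    for t c d \<sigma> C
  proof -
    have t': "0 < t" "t < T" using t cd by auto
    then have r: "1 < pos t" "pos t < \<gamma>" using range by auto
    have "((\<lambda>t. (vel t)\<^sup>2 / 2 - potential \<sigma> (pos t)) has_real_derivative (\<sigma> - u t) * pos t * vel t) (at t)"
      using energy_has_derivative[of t \<sigma>] at_within_Icc_at[of 0 t T] t t' by simp
    moreover have "((\<lambda>t. (vel t)\<^sup>2 / 2 - potential \<sigma> (pos t)) has_real_derivative 0) (at t)"
      by (rule has_field_derivative_transform_within_open[OF DERIV_const[of C], of "{c<..<d}"])
        (use t energy in auto)
    ultimately have "(\<sigma> - u t) * pos t * vel t = 0" by (rule DERIV_unique)
    moreover have "vel t > 0" using speed[OF t'] max_kinetic_pos[OF r] by simp
    ultimately show ?thesis using r by simp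
  qed
  have energy: "(vel t)\<^sup>2 / 2 = max_kinetic \<gamma> (pos t)" if "0 < t" "t < T" for t
    using speed[OF that] max_kinetic_pos[of "pos t"] range[OF that] by simp
  have switch: "switch_point \<gamma> \<in> {1..\<gamma>}" using switch_point_bounds by simp
  have "(vel t)\<^sup>2 / 2 - potential (-1) (pos t) = - potential (-1) 1" if "0 < t" "t < t1" for t
  proof -
    have t: "0 < t" "t < T" using that t1 by auto
    have "pos t < switch_point \<gamma>"
      using travel_time_less_iff[OF pos_range switch, of t] time[of t] that t unfolding t1_def by simp
    then show ?thesis using energy[OF t] max_kinetic_before_switch[of "pos t"] range[OF t] by linarith
  qed
  then have before: "u t = -1" if "t \<in> {0<..<t1} - exceptional" for t
    using control[of 0 t t1 "-1"] that t1 by auto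
  have "(vel t)\<^sup>2 / 2 - potential 1 (pos t) = - potential 1 \<gamma>" if "t1 < t" "t < T" for t
  proof -
    have t: "0 < t" "t < T" using that t1 by auto
    have "switch_point \<gamma> < pos t"
      using travel_time_less_iff[OF switch pos_range, of t] time[of t] that t unfolding t1_def by simp
    then show ?thesis using energy[OF t] max_kinetic_after_switch[of "pos t"] by linarith
  qed
  then have after: "u t = 1" if "t \<in> {t1<..<T} - exceptional" for t
    using control[of t1 t T 1] that t1 by auto
  show ?thesis
    by (rule form_XY_if_control_switches[OF t1])
      (auto intro!: AE_lebesgue_onI[OF negligible_exceptional] before after)
qed

end

section \<open>Existence of a process of minimal time\<close>

text \<open>
  The position \<open>\<phi>\<close> is the inverse function of \<open>travel_time\<close>. Its derivative is the maximal speed \<open>v\<close>,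
  and differentiating \<open>v\<^sup>2 / 2 = potential \<sigma> \<phi> - C\<close> on each side of the switching time gives the
  equation of motion for the constant control \<open>\<sigma>\<close>. Both components are continuous with bounded
  derivative off a finite set, hence absolutely continuous, although the pace is singular at
  both ends.
\<close>

lemma ex_feasible_travel_time:
  fixes \<gamma> :: real
  assumes gamma: "\<gamma> > 1"
  shows "\<exists>u x. feasible \<gamma> (travel_time \<gamma> \<gamma>) u x"
proof -
  define T where "T = travel_time \<gamma> \<gamma>"
  define t1 where "t1 = travel_time \<gamma> (switch_point \<gamma>)"
  define \<phi> where "\<phi> = the_inv_into {1..\<gamma>} (travel_time \<gamma>)"
  define v where "v = (\<lambda>t. sqrt (2 * max_kinetic \<gamma> (\<phi> t)))"
  define u :: "real \<Rightarrow> real" where "u = (\<lambda>t. if t < t1 then - 1 else 1)"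
  define D where "D = (\<lambda>t. (v t, 1 / (\<phi> t)\<^sup>2 - u t * \<phi> t))"
  note less_iff = travel_time_less_iff[OF gamma]
  note time_1 = travel_time_1[OF gamma]
  have inj: "inj_on (travel_time \<gamma>) {1..\<gamma>}"
    by (rule strict_mono_on_imp_inj_on[OF travel_time_strict_mono[OF gamma]])
  have t1: "0 < t1" "t1 < T"
    using less_iff[of 1 "switch_point \<gamma>"] less_iff[of "switch_point \<gamma>" \<gamma>]
      switch_point_bounds[OF gamma] time_1 gamma unfolding t1_def T_def by auto
  have image: "travel_time \<gamma> ` {1..\<gamma>} = {0..T}"
  proof
    show "travel_time \<gamma> ` {1..\<gamma>} \<subseteq> {0..T}"
    proof clarify
      fix q assume "q \<in> {1..\<gamma>}"
      then show "travel_time \<gamma> q \<in> {0..T}"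
        using less_iff[of q 1] less_iff[of \<gamma> q] gamma time_1 unfolding T_def by auto
    qed
    show "{0..T} \<subseteq> travel_time \<gamma> ` {1..\<gamma>}"
    proof
      fix t assume "t \<in> {0..T}"
      then show "t \<in> travel_time \<gamma> ` {1..\<gamma>}"
        using IVT'[of "travel_time \<gamma>" 1 t \<gamma>] gamma continuous_travel_time[OF gamma] time_1
        unfolding T_def by auto
    qed
  qed
  have \<phi>: "\<phi> t \<in> {1..\<gamma>}" "travel_time \<gamma> (\<phi> t) = t" if "t \<in> {0..T}" for t
    using that unfolding image[symmetric] \<phi>_def
    by (auto intro: f_the_inv_into_f[OF inj] the_inv_into_into[OF inj _ order_refl] simp del: atLeastAtMost_iff)
  have \<phi>_eq: "\<phi> (travel_time \<gamma> q) = q" if "q \<in> {1..\<gamma>}" for q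
    unfolding \<phi>_def by (rule the_inv_into_f_f[OF inj that])
  have \<phi>_ends: "\<phi> 0 = 1" "\<phi> T = \<gamma>"
    using \<phi>_eq[of 1] \<phi>_eq[of \<gamma>] time_1 gamma unfolding T_def by auto
  have cont_\<phi>: "continuous_on {0..T} \<phi>"
    using continuous_on_inv[OF continuous_travel_time[OF gamma], of \<phi>] \<phi>_eq unfolding image by auto
  have cont_v: "continuous_on {0..T} v"
    unfolding v_def using \<phi>(1)
    by (intro continuous_intros continuous_on_compose2[OF continuous_max_kinetic[OF gamma] cont_\<phi>])
      (force simp: less_le_trans[OF zero_less_one])
  have interior: "1 < \<phi> t" "\<phi> t < \<gamma>" if "0 < t" "t < T" for t
    using less_iff[of 1 "\<phi> t"] less_iff[of "\<phi> t" \<gamma>] \<phi>[of t] that gamma time_1 unfolding T_def by auto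
  have \<phi>': "(\<phi> has_real_derivative v t) (at t)" if t: "0 < t" "t < T" for t
  proof -
    have "isCont \<phi> t"
      using continuous_on_interior[OF cont_\<phi>, of t] t by simp
    then have "(\<phi> has_real_derivative inverse (pace \<gamma> (\<phi> t))) (at t)"
      using travel_time_has_derivative[OF gamma interior[OF t]] pace_pos[OF gamma interior[OF t]] t \<phi>(2)
      by (intro DERIV_inverse_function[where f = "travel_time \<gamma>" and a = 0 and b = T]) auto
    then show ?thesis unfolding pace_def v_def by (simp add: inverse_eq_divide)
  qed
  have v': "(v has_real_derivative 1 / (\<phi> t)\<^sup>2 - \<sigma> * \<phi> t) (at t)"
    if t: "t \<in> I" "open I" "I \<subseteq> {0<..<T}"
      and energy: "\<And>s. s \<in> I \<Longrightarrow> max_kinetic \<gamma> (\<phi> s) = potential \<sigma> (\<phi> s) - C" for t I \<sigma> C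
  proof -
    have t': "0 < t" "t < T" using t by auto
    define w where "w = potential \<sigma> (\<phi> t) - C"
    have w: "w > 0" "v t = sqrt (2 * w)"
      using max_kinetic_pos[OF gamma interior[OF t']] energy[OF t(1)] unfolding w_def v_def by auto
    have "((\<lambda>s. potential \<sigma> (\<phi> s)) has_real_derivative (1 / (\<phi> t)\<^sup>2 - \<sigma> * \<phi> t) * v t) (at t)"
      using interior[OF t'] by (intro DERIV_chain2[OF potential_has_derivative] \<phi>' t') auto
    then have "((\<lambda>s. 2 * (potential \<sigma> (\<phi> s) - C)) has_real_derivative
        2 * ((1 / (\<phi> t)\<^sup>2 - \<sigma> * \<phi> t) * v t)) (at t)"
      by (auto intro!: derivative_eq_intros)
    from DERIV_chain2[where f = sqrt, OF DERIV_real_sqrt this]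
    have "((\<lambda>s. sqrt (2 * (potential \<sigma> (\<phi> s) - C))) has_real_derivative
        inverse (sqrt (2 * w)) / 2 * (2 * ((1 / (\<phi> t)\<^sup>2 - \<sigma> * \<phi> t) * v t))) (at t)"
      using w unfolding w_def by simp
    moreover have "inverse (sqrt (2 * w)) / 2 * (2 * ((1 / (\<phi> t)\<^sup>2 - \<sigma> * \<phi> t) * v t))
        = 1 / (\<phi> t)\<^sup>2 - \<sigma> * \<phi> t"
      using w by simp
    ultimately have "((\<lambda>s. sqrt (2 * (potential \<sigma> (\<phi> s) - C))) has_real_derivative
        1 / (\<phi> t)\<^sup>2 - \<sigma> * \<phi> t) (at t)" by (rule DERIV_cong)
    then show ?thesis
      by (rule has_field_derivative_transform_within_open[OF _ t(2,1)]) (simp add: v_def energy)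
  qed
  have switch: "switch_point \<gamma> \<in> {1..\<gamma>}" using switch_point_bounds[OF gamma] by simp
  have before: "max_kinetic \<gamma> (\<phi> s) = potential (-1) (\<phi> s) - potential (-1) 1" if "s \<in> {0<..<t1}" for s
    using less_iff[OF _ switch, of "\<phi> s"] \<phi>[of s] that t1 unfolding t1_def[symmetric]
    by (intro max_kinetic_before_switch[OF gamma]) auto
  have after: "max_kinetic \<gamma> (\<phi> s) = potential 1 (\<phi> s) - potential 1 \<gamma>" if "s \<in> {t1<..<T}" for s
    using less_iff[OF switch, of "\<phi> s"] \<phi>[of s] that t1 unfolding t1_def[symmetric]
    by (intro max_kinetic_after_switch[OF gamma]) auto
  have x': "((\<lambda>t. (\<phi> t, v t)) has_vector_derivative D t) (at t)" if t: "t \<in> {0<..<T} - {t1}" for t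
  proof -
    have sub: "{0<..<t1} \<subseteq> {0<..<T}" "{t1<..<T} \<subseteq> {0<..<T}" using t1 by auto
    have sub: "{0<..<t1} \<subseteq> {0<..<T}" "{t1<..<T} \<subseteq> {0<..<T}" using t1 by auto
    have "(v has_real_derivative 1 / (\<phi> t)\<^sup>2 - u t * \<phi> t) (at t)"
    proof (cases "t < t1")
      case True
      then show ?thesis using v'[of t "{0<..<t1}", OF _ _ sub(1) before] t unfolding u_def by auto
    next
      case False
      then show ?thesis using v'[of t "{t1<..<T}", OF _ _ sub(2) after] t unfolding u_def by auto
    qed
    then show ?thesis
      using \<phi>'[of t] t unfolding D_def has_real_derivative_iff_has_vector_derivative
      by (intro has_vector_derivative_Pair) auto
  qed
  have "bounded (v ` {0..T})"
    by (intro compact_imp_bounded compact_continuous_image cont_v) auto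
  then obtain B where B: "\<forall>r\<in>v ` {0..T}. norm r \<le> B" unfolding bounded_iff ..
  then have "B \<ge> 0" using t1 by (force intro: order_trans[OF norm_ge_zero])
  have D_bound: "norm (D t) \<le> B + (1 + \<gamma>)" if "t \<in> {0<..<T}" for t
  proof -
    have q: "1 \<le> \<phi> t" "\<phi> t \<le> \<gamma>" using \<phi>(1)[of t] that by auto
    then have "0 \<le> 1 / (\<phi> t)\<^sup>2" "1 / (\<phi> t)\<^sup>2 \<le> 1" by (auto simp: one_le_power)
    moreover have "\<bar>u t * \<phi> t\<bar> \<le> \<gamma>" using q unfolding u_def by (simp add: abs_mult)
    ultimately have "\<bar>1 / (\<phi> t)\<^sup>2 - u t * \<phi> t\<bar> \<le> 1 + \<gamma>" by linarith
    moreover have "\<bar>v t\<bar> \<le> B" using B that by auto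
    ultimately show ?thesis
      using norm_Pair_le[of "v t" "1 / (\<phi> t)\<^sup>2 - u t * \<phi> t"] unfolding D_def by simp
  qed
  have "absolutely_continuous_on_interval 0 T (\<lambda>t. (\<phi> t, v t))"
    by (rule bounded_derivative_imp_absolutely_continuous[of _ _ _ "{t1}" "B + (1 + \<gamma>)" D])
      (use x' D_bound \<open>B \<ge> 0\<close> gamma in \<open>auto intro!: continuous_intros cont_\<phi> cont_v\<close>)
  moreover have "\<forall>t\<in>{0..T}. (\<phi> t, v t) \<in> state_space"
  proof
    fix t assume "t \<in> {0..T}"
    then show "(\<phi> t, v t) \<in> state_space"
      using \<phi>(1)[of t] max_kinetic_nonneg[OF gamma, of "\<phi> t"] unfolding state_space_def v_def by simp
  qed
  moreover have "AE t in lebesgue_on {0..T}. ((\<lambda>t. (\<phi> t, v t)) has_vector_derivative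
      f_field (\<phi> t, v t) + u t *\<^sub>R g_field (\<phi> t, v t)) (at t within {0..T})"
  proof (rule AE_lebesgue_onI[of "{0, t1, T}"])
    fix t assume "t \<in> {0..T} - {0, t1, T}"
    then show "((\<lambda>t. (\<phi> t, v t)) has_vector_derivative
      f_field (\<phi> t, v t) + u t *\<^sub>R g_field (\<phi> t, v t)) (at t within {0..T})"
      using x'[of t] unfolding D_def f_field_def g_field_def
      by (auto intro: has_vector_derivative_at_within)
  qed auto
  ultimately have "trajectory u 0 T (\<lambda>t. (\<phi> t, v t))"
    unfolding trajectory_def solution_def by blast
  moreover have "admissible_control T u"
  proof -
    have "u \<in> borel_measurable borel" unfolding u_def by measurable
    then have "u \<in> borel_measurable (lebesgue_on {0..T})"
      by (intro measurable_restrict_space1 measurable_completion) simp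
    then show ?thesis unfolding admissible_control_def by (auto simp: u_def)
  qed
  moreover have "v 0 = 0" "v T = 0"
    unfolding v_def using \<phi>_ends max_kinetic_ends[OF gamma] by auto
  ultimately have "feasible \<gamma> T u (\<lambda>t. (\<phi> t, v t))"
    using \<phi>_ends t1 unfolding feasible_def by simp
  then show ?thesis unfolding T_def by blast
qed

theorem proposition2:
  fixes \<gamma> :: real
  assumes "\<gamma> > 1"
  shows "(\<exists>T u x. time_optimal \<gamma> T u x) \<and>
         (\<forall>T u x. time_optimal \<gamma> T u x \<longrightarrow> form_XY T u x)"
proof -
  obtain u0 x0 where feas0: "feasible \<gamma> (travel_time \<gamma> \<gamma>) u0 x0"
    using ex_feasible_travel_time[OF assms] by blast
  then have "time_optimal \<gamma> (travel_time \<gamma> \<gamma>) u0 x0"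
    using feasible_time_lower_bound(1)[OF assms] unfolding time_optimal_def by blast
  moreover have "form_XY T u x" if "time_optimal \<gamma> T u x" for T u x
  proof -
    have feas: "feasible \<gamma> T u x" and "T \<le> travel_time \<gamma> \<gamma>"
      using that feas0 unfolding time_optimal_def by auto
    then have "T = travel_time \<gamma> \<gamma>"
      using feasible_time_lower_bound(1)[OF assms feas] by simp
    with feas show ?thesis by (rule minimal_time_imp_form_XY[OF assms])
  qed
  ultimately show ?thesis by blast
qed

end
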